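(* Let $c>0$, and let $\mathcal H_c$, $\mathcal A$, $\mathcal G_R^\kappa$ and $\mathsf E_R$ be as in the context. For $0<\gamma\le c$ and any fixed $\kappa\ge0$, $$\min\bigl\{\|\mathsf E_R\|_F:\ R\in\mathbb R^{3\times3},\ \mathcal G_R^\kappa\succeq\gamma\mathcal A\bigr\}=2\gamma\,\|\mathsf E_{I_3}\|_F ,$$ and the minimum is attained by $R=2\gamma I_3$. For $\gamma>c$, no $R\in\mathbb R^{3\times3}$ satisfies $\mathcal G_R^\kappa\succeq\gamma\mathcal A$.
   Context: For $A,B\in\mathbb R^{3\times3}$: $A:B=\operatorname{tr}(A^TB)$, $\operatorname{cof}A$ is the matrix of signed $2\times2$ minors, $A\times B=\operatorname{cof}(A+B)-\operatorname{cof}A-\operatorname{cof}B$; $\|\cdot\|_F$ is the Frobenius norm. For symmetric bilinear forms on $\mathbb R^{3\times3}$, $\mathcal B\succeq\mathcal C$ means $\mathcal B[H,H]\ge\mathcal C[H,H]$ for all $H$. Material: $W_{\mathrm{iso}}(F)=c_1(J^{-2/3}F:F-3)+c_2(J^{-4/3}\operatorname{cof}F:\operatorname{cof}F-3)$, $J=\det F>0$, with $c_1,c_2\ge0$ and $c_1+c_2=c>0$; $\mathcal H_c=D^2W_{\mathrm{iso}}(I_3)$ (depends only on $c$). $\mathcal A[H,L]=2H:L+\frac23(\operatorname{tr}H)(\operatorname{tr}L)$. For $R\in\mathbb R^{3\times3}$ and $\kappa\ge0$, $$\mathcal G_R^\kappa[H,L]=\mathcal H_c[H,L]+R:(H\times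 L)+\kappa(\operatorname{tr}H)(\operatorname{tr}L).$$ Defect matrix: fix a parent cell $\widehat K$, a geometry map $X:\widehat K\to\mathbb R^3$, a finite cubature rule $\mathcal Q$ on $\widehat K$ with error functional $\mathcal L[f]=\mathcal Q[f]-\int_{\widehat K}f\,d\xi$, and scalar basis functions $\phi_1,\dots,\phi_d$ used for all three components of the vector variations. $\mathsf E_R\in\mathbb R^{3d\times3d}$ is the matrix, in the vector basis $\{\phi_ae_i\}$, of the symmetric bilinear form $(u,v)\mapsto\mathcal L[D_\xi(RX):(D_\xi u\times D_\xi v)]$, where $D_\xi$ is the Jacobian in parent coordinates (rows are vector components). *)

theory Defs
  imports "HOL-Analysis.Analysis"
begin

section \<open>Matrix algebra\<close>

definition ddot :: "real^3^3 \<Rightarrow> real^3^3 \<Rightarrow> real"  (infixl "\<bullet>\<bullet>" 70) where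
  "A \<bullet>\<bullet> B = trace (transpose A ** B)"

definition cof :: "real^3^3 \<Rightarrow> real^3^3" where
  "cof A = vector
     [vector [A$2$2 * A$3$3 - A$2$3 * A$3$2,
              - (A$2$1 * A$3$3 - A$2$3 * A$3$1),
              A$2$1 * A$3$2 - A$2$2 * A$3$1],
      vector [- (A$1$2 * A$3$3 - A$1$3 * A$3$2),
              A$1$1 * A$3$3 - A$1$3 * A$3$1,
              - (A$1$1 * A$3$2 - A$1$2 * A$3$1)],
      vector [A$1$2 * A$2$3 - A$1$3 * A$2$2,
              - (A$1$1 * A$2$3 - A$1$3 * A$2$1),
              A$1$1 * A$2$2 - A$1$2 * A$2$1]]"

definition mat_cross :: "real^3^3 \<Rightarrow> real^3^3 \<Rightarrow> real^3^3"  (infixl "\<otimes>" 75) where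
  "A \<otimes> B = cof (A + B) - cof A - cof B"

section \<open>Bilinear forms of the material\<close>

type_synonym form = "real^3^3 \<Rightarrow> real^3^3 \<Rightarrow> real"

definition form_ge :: "form \<Rightarrow> form \<Rightarrow> bool"  (infix "\<succeq>" 50) where
  "B \<succeq> C \<longleftrightarrow> (\<forall>H. B H H \<ge> C H H)"

text \<open>The energy is meaningful only where the determinant is positive; this is an open set
  containing the identity, so the values elsewhere do not affect the Hessian below.\<close>

definition W_iso :: "real \<Rightarrow> real \<Rightarrow> real^3^3 \<Rightarrow> real" where
  "W_iso c1 c2 F =
     c1 * (det F powr (- 2/3) * (F \<bullet>\<bullet> F) - 3) +
     c2 * (det F powr (- 4/3) * (cof F \<bullet>\<bullet> cof F) - 3)"

text \<open>Second Frechet derivative at \<open>F\<close>, as a bilinear form.\<close>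

definition second_derivative :: "(real^3^3 \<Rightarrow> real) \<Rightarrow> real^3^3 \<Rightarrow> form" where
  "second_derivative W F H L =
     frechet_derivative (\<lambda>G. frechet_derivative W (at G) L) (at F) H"

definition form_H :: "real \<Rightarrow> real \<Rightarrow> form" where
  "form_H c1 c2 = second_derivative (W_iso c1 c2) (mat 1)"

definition form_A :: form where
  "form_A H L = 2 * (H \<bullet>\<bullet> L) + 2/3 * trace H * trace L"

definition form_G :: "real \<Rightarrow> real \<Rightarrow> real \<Rightarrow> real^3^3 \<Rightarrow> form" where
  "form_G c1 c2 \<kappa> R H L = form_H c1 c2 H L + R \<bullet>\<bullet> (H \<otimes> L) + \<kappa> * trace H * trace L"

section \<open>The defect matrix\<close>

text \<open>A cubature rule is given by its finite set \<open>P\<close> of nodes and its weights \<open>w\<close>.\<close>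

definition cubature_error ::
    "(real^3) set \<Rightarrow> (real^3) set \<Rightarrow> (real^3 \<Rightarrow> real) \<Rightarrow> (real^3 \<Rightarrow> real) \<Rightarrow> real" where
  "cubature_error K P w f = (\<Sum>p\<in>P. w p * f p) - integral K f"

text \<open>Derivatives are taken within the cell \<open>K\<close>, so that nodes on its boundary are allowed and
  only the values of the fields on \<open>K\<close> matter.\<close>

definition defect_integrand ::
    "(real^3) set \<Rightarrow> (real^3 \<Rightarrow> real^3) \<Rightarrow> real^3^3 \<Rightarrow>
     (real^3 \<Rightarrow> real^3) \<Rightarrow> (real^3 \<Rightarrow> real^3) \<Rightarrow> real^3 \<Rightarrow> real" where
  "defect_integrand K X R u v \<xi> =
     jacobian (\<lambda>\<eta>. R *v X \<eta>) (at \<xi> within K) \<bullet>\<bullet>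
       (jacobian u (at \<xi> within K) \<otimes> jacobian v (at \<xi> within K))"

definition vector_basis :: "('d \<Rightarrow> real^3 \<Rightarrow> real) \<Rightarrow> 'd \<times> 3 \<Rightarrow> real^3 \<Rightarrow> real^3" where
  "vector_basis \<phi> q \<xi> = \<phi> (fst q) \<xi> *\<^sub>R axis (snd q) 1"

text \<open>With \<open>d\<close> scalar basis functions indexed by \<^typ>\<open>'d\<close>, rows and columns are indexed by
  \<^typ>\<open>'d \<times> 3\<close>. The library's \<^const>\<open>norm\<close> on this type is the Frobenius norm.\<close>

definition defect_matrix ::
    "(real^3) set \<Rightarrow> (real^3) set \<Rightarrow> (real^3 \<Rightarrow> real) \<Rightarrow> (real^3 \<Rightarrow> real^3) \<Rightarrow>
     ('d::finite \<Rightarrow> real^3 \<Rightarrow> real) \<Rightarrow> real^3^3 \<Rightarrow> real^('d \<times> 3)^('d \<times> 3)" where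
  "defect_matrix K P w X \<phi> R =
     (\<chi> p q. cubature_error K P w
               (defect_integrand K X R (vector_basis \<phi> p) (vector_basis \<phi> q)))"

definition linearly_independent_on ::
    "(real^3) set \<Rightarrow> ('d::finite \<Rightarrow> real^3 \<Rightarrow> real) \<Rightarrow> bool" where
  "linearly_independent_on K \<phi> \<longleftrightarrow>
     (\<forall>\<alpha>. (\<forall>\<xi>\<in>K. (\<Sum>a\<in>UNIV. \<alpha> a * \<phi> a \<xi>) = 0) \<longrightarrow> (\<forall>a. \<alpha> a = 0))"

end

theory Submission
  imports Defs
begin

text \<open>The Hessian is \<open>\<H>\<^sub>c[H,H] = 4 c \<bar>dev sym H\<bar>\<^sup>2\<close>, so that \<open>R = 2 \<gamma> I\<close> turns
  \<open>\<G> - \<gamma> \<A>\<close> into \<open>4 (c - \<gamma>) \<bar>dev sym H\<bar>\<^sup>2 + \<kappa> (tr H)\<^sup>2\<close>. Testing with traceless rank-one matrices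
  forces \<open>\<gamma> \<le> c\<close>, and testing with skew matrices forces \<open>x \<bullet> R x \<ge> 2 \<gamma> \<bar>x\<bar>\<^sup>2\<close>, hence
  \<open>\<bar>R z\<bar> \<ge> 2 \<gamma> \<bar>z\<bar>\<close> for all \<open>z\<close>. Finally, the entries of the defect matrix are
  \<open>(e\<^sub>i \<times> e\<^sub>j) \<bullet> R z\<^sub>a\<^sub>b\<close> with vectors \<open>z\<^sub>a\<^sub>b\<close> independent of \<open>R\<close>, so its squared norm is
  \<open>2 \<Sum> \<bar>R z\<^sub>a\<^sub>b\<bar>\<^sup>2\<close>, which \<open>R = 2 \<gamma> I\<close> minimizes.\<close>

section \<open>Algebra of the matrix cross product\<close>

lemma ddot_eq_inner: "A \<bullet>\<bullet> B = A \<bullet> B"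
  by (simp add: ddot_def trace_def matrix_matrix_mult_def transpose_def inner_vec_def sum_3)

lemmas mat_cross_simps = mat_cross_def cof_def vec_eq_iff forall_3 inner_vec_def sum_3

lemma mat_cross_self: "A \<otimes> A = 2 *\<^sub>R cof A"
  by (simp add: mat_cross_simps algebra_simps)

lemma bounded_bilinear_mat_cross: "bounded_bilinear (\<otimes>)"
  unfolding bilinear_conv_bounded_bilinear[symmetric] bilinear_def
  by (auto intro!: linearI simp: mat_cross_simps algebra_simps)

text \<open>Up to a factor, \<open>(A \<otimes> B) \<bullet> C\<close> is the polarization of the
  determinant, hence symmetric in all three arguments.\<close>

lemma mat_cross_inner_swap: "(A \<otimes> B) \<bullet> C = (A \<otimes> C) \<bullet> B"
  by (simp add: mat_cross_simps algebra_simps)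

lemma mat_cross_commute: "A \<otimes> B = B \<otimes> A"
  by (simp add: mat_cross_def add.commute)

text \<open>Expresses the determinant through a bounded bilinear map, so that the product rule can
  differentiate it.\<close>

lemma det_eq_mat_cross: "det A = ((A \<otimes> A) \<bullet> A) / 6"
  by (simp add: mat_cross_simps det_3 algebra_simps)

lemma mat_cross_id: "mat 1 \<otimes> H = trace H *\<^sub>R mat 1 - transpose H"
  by (simp add: mat_cross_simps mat_def transpose_def trace_def algebra_simps)

section \<open>First derivative of the energy\<close>

lemmas has_derivative_mat_cross [derivative_intros] =
  bounded_bilinear.FDERIV[OF bounded_bilinear_mat_cross]

text \<open>Jacobi's formula, as half of \<open>G \<otimes> G\<close> is \<open>cof G\<close>. By
  symmetry the three product rule terms coincide, which turns 1/6 into 1/2.\<close>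

lemma has_derivative_det:
  "(det has_derivative (\<lambda>L. ((G \<otimes> G) \<bullet> L) / 2)) (at G)"
proof -
  have "((\<lambda>A. ((A \<otimes> A) \<bullet> A) / 6) has_derivative (\<lambda>L. ((G \<otimes> G) \<bullet> L) / 2)) (at G)"
    apply (rule derivative_eq_intros refl)+
     apply simp
    apply (rule ext)
    subgoal for L
      by (simp only: mat_cross_commute[of L G] mat_cross_inner_swap[of G L G] inner_add_left)
        simp
    done
  then show ?thesis
    by (simp add: det_eq_mat_cross[abs_def])
qed

lemma has_derivative_det_powr:
  assumes "det G > 0"
  shows "((\<lambda>A. det A powr a) has_derivative
           (\<lambda>L. a * det G powr (a - 1) * (((G \<otimes> G) \<bullet> L) / 2))) (at G)"
proof -
  have "((\<lambda>A. det A powr a) has_derivative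
           (\<lambda>L. (det G powr a) * (0 * ln (det G) + (((G \<otimes> G) \<bullet> L) / 2) * a / det G))) (at G)"
    using assms by (intro has_derivative_powr has_derivative_det) auto
  then show ?thesis
    using assms by (simp add: powr_diff[of "det G" a 1] mult_ac)
qed

text \<open>With \<open>cof G\<close> written as half of \<open>G \<otimes> G\<close>, the
  coefficients 1/3 and 1/6 arise as \<open>2/3 * 1/2\<close> and
  \<open>4/3 * 1/2 * 1/4\<close>.\<close>

definition W_iso_deriv :: "real \<Rightarrow> real \<Rightarrow> real^3^3 \<Rightarrow> real^3^3 \<Rightarrow> real" where
  "W_iso_deriv c1 c2 G L =
     c1 * (det G powr (-2/3) * (2 * (G \<bullet> L))
           - 1/3 * (det G powr (-5/3) * ((G \<otimes> G) \<bullet> L) * (G \<bullet> G))) +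
     c2 * (det G powr (-4/3) * ((G \<otimes> G) \<bullet> (G \<otimes> L))
           - 1/6 * (det G powr (-7/3) * ((G \<otimes> G) \<bullet> L) * ((G \<otimes> G) \<bullet> (G \<otimes> G))))"

lemma W_iso_eq:
  "W_iso c1 c2 G =
     c1 * (det G powr (-2/3) * (G \<bullet> G) - 3) +
     c2 * (det G powr (-4/3) * (1/4 * ((G \<otimes> G) \<bullet> (G \<otimes> G))) - 3)"
  by (simp add: W_iso_def ddot_eq_inner mat_cross_self)

lemma has_derivative_W_iso:
  assumes "det G > 0"
  shows "(W_iso c1 c2 has_derivative W_iso_deriv c1 c2 G) (at G)"
  unfolding W_iso_eq[abs_def]
  apply (rule has_derivative_det_powr[OF assms] derivative_eq_intros refl)+
  apply (rule ext)
  subgoal for L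
    apply (simp only: mat_cross_commute[of L G] inner_add_left inner_add_right)
    apply (simp add: W_iso_deriv_def inner_commute[of L G] inner_commute[of "G \<otimes> L"] field_simps)
    done
  done

section \<open>Hessian at the identity\<close>

lemma mat_cross_id_id: "mat 1 \<otimes> mat 1 = 2 *\<^sub>R mat 1"
  by (simp add: mat_cross_simps mat_def)

lemma inner_id_mat_cross_id: "mat 1 \<bullet> (mat 1 \<otimes> H) = 2 * (mat 1 \<bullet> H)"
  by (simp add: inner_commute[of "mat 1"] mat_cross_inner_swap[of "mat 1" H] mat_cross_id_id)

lemma inner_id_id: "(mat 1 :: real^3^3) \<bullet> mat 1 = 3"
  by (simp add: inner_vec_def sum_3 mat_def)

lemma form_H_eq:
  "form_H c1 c2 H H = (c1 + c2) * (2 * (H \<bullet> H) + 2 * (H \<bullet> transpose H) - 4/3 * (trace H)\<^sup>2)"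
proof -
  let ?I = "mat 1 :: real^3^3"
  \<comment> \<open>The product rule applied to \<open>W_iso_deriv\<close> in direction
    \<open>L\<close>, evaluated with \<open>det ?I = 1\<close>,
    \<open>?I \<otimes> ?I = 2 *\<^sub>R ?I\<close> and \<open>?I \<bullet> ?I = 3\<close>.\<close>
  let ?D = "\<lambda>L. c1 * (2 * (L \<bullet> H) - 4/3 * (?I \<bullet> L) * (?I \<bullet> H)
      - 2/3 * (3 * ((?I \<otimes> L) \<bullet> H) - 3 * (?I \<bullet> H) * (?I \<bullet> L))) +
    c2 * (- 16/3 * (?I \<bullet> L) * (?I \<bullet> H) + 2 * ((?I \<otimes> L) \<bullet> (?I \<otimes> H)) + 2 * (?I \<bullet> (L \<otimes> H))
      - 4/3 * (3 * ((?I \<otimes> L) \<bullet> H) - 3 * (?I \<bullet> L) * (?I \<bullet> H)))"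
  have det_pos: "0 < det ?I" by simp
  \<comment> \<open>\<open>W_iso_deriv\<close> is known to be the derivative only where the
    determinant is positive; openness makes this enough near the identity.\<close>
  have op: "open {G :: real^3^3. 0 < det G}"
    by (intro open_Collect_less continuous_intros continuous_at_imp_continuous_on ballI
        has_derivative_continuous[OF has_derivative_det])
  have D: "((\<lambda>G. W_iso_deriv c1 c2 G H) has_derivative ?D) (at ?I)"
    unfolding W_iso_deriv_def
    apply (rule has_derivative_det_powr[OF det_pos] derivative_eq_intros refl)+
    apply (rule ext)
    subgoal for L
      apply (simp only: mat_cross_commute[of L ?I] inner_add_left inner_add_right)
      apply (simp add: mat_cross_id_id inner_commute[of L ?I] inner_commute[of "?I \<otimes> L" ?I]
          bounded_bilinear.zero_right[OF bounded_bilinear_mat_cross] inner_id_mat_cross_id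
          inner_id_id)
      apply (simp add: field_simps)
      done
    done
  have "((\<lambda>G. frechet_derivative (W_iso c1 c2) (at G) H) has_derivative ?D) (at ?I)"
    by (rule has_derivative_transform_within_open[OF D op])
       (auto simp flip: frechet_derivative_at[OF has_derivative_W_iso])
  then have "form_H c1 c2 H H = ?D H"
    unfolding form_H_def second_derivative_def by (simp flip: frechet_derivative_at)
  \<comment> \<open>With these values the brackets of \<open>c1\<close> and \<open>c2\<close> become
    the same quadratic form, so only \<open>c1 + c2\<close> survives.\<close>
  moreover have "?I \<bullet> H = trace H" and "(?I \<otimes> H) \<bullet> H = (trace H)\<^sup>2 - H \<bullet> transpose H"
    and "?I \<bullet> (H \<otimes> H) = (trace H)\<^sup>2 - H \<bullet> transpose H"
    and "(?I \<otimes> H) \<bullet> (?I \<otimes> H) = H \<bullet> H + (trace H)\<^sup>2"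
    unfolding mat_cross_id mat_cross_self
    by (simp_all add: inner_vec_def sum_3 trace_def mat_def cof_def transpose_def
          algebra_simps power2_eq_square)
  ultimately show ?thesis
    by (simp add: algebra_simps add_divide_distrib power2_eq_square)
qed

section \<open>Which matrices \<open>R\<close> are feasible\<close>

lemma form_G_minus_form_A:
  assumes "c1 + c2 = c"
  shows "form_G c1 c2 \<kappa> R H H - \<gamma> * form_A H H =
    2 * (c - \<gamma>) * (H \<bullet> H) + 2 * c * (H \<bullet> transpose H) + 2 * (R \<bullet> cof H)
    + (\<kappa> - 4/3 * c - 2/3 * \<gamma>) * (trace H)\<^sup>2"
  unfolding assms[symmetric]
  by (simp add: form_G_def form_A_def form_H_eq ddot_eq_inner mat_cross_self algebra_simps
      power2_eq_square)

lemma form_G_scaled_id_ge: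
  assumes "c1 + c2 = c" "\<gamma> \<le> c" "\<kappa> \<ge> 0"
  shows "form_G c1 c2 \<kappa> ((2 * \<gamma>) *\<^sub>R mat 1) \<succeq> (\<lambda>H L. \<gamma> * form_A H L)"
  unfolding form_ge_def
proof
  fix H :: "real^3^3"
  \<comment> \<open>The deviatoric symmetric part of \<open>H\<close>.\<close>
  define S where "S = (1/2) *\<^sub>R (H + transpose H) - (trace H / 3) *\<^sub>R mat 1"
  have "transpose H \<bullet> transpose H = H \<bullet> H" "transpose H \<bullet> H = H \<bullet> transpose H"
    "H \<bullet> mat 1 = trace H" "transpose H \<bullet> mat 1 = trace H"
    "mat 1 \<bullet> H = trace H" "mat 1 \<bullet> transpose H = trace H"
    by (simp_all add: inner_vec_def sum_3 trace_def mat_def transpose_def)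
  then have "S \<bullet> S = (H \<bullet> H + H \<bullet> transpose H) / 2 - (trace H)\<^sup>2 / 3"
    by (simp add: S_def inner_add_left inner_add_right inner_diff_left inner_diff_right
        inner_id_id field_simps power2_eq_square)
  \<comment> \<open>This is the trace of \<open>cof H\<close>, times \<open>2 * \<gamma>\<close>.
    Its double, minus \<open>\<gamma> * form_A H H\<close>, equals
    \<open>- 4 * \<gamma> * (S \<bullet> S)\<close>.\<close>
  moreover have "((2 * \<gamma>) *\<^sub>R mat 1) \<bullet> cof H = \<gamma> * ((trace H)\<^sup>2 - H \<bullet> transpose H)"
    by (simp add: inner_vec_def sum_3 trace_def mat_def cof_def transpose_def
          algebra_simps power2_eq_square)
  ultimately have "form_G c1 c2 \<kappa> ((2 * \<gamma>) *\<^sub>R mat 1) H H - \<gamma> * form_A H H =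
      4 * (c - \<gamma>) * (S \<bullet> S) + \<kappa> * (trace H)\<^sup>2"
    unfolding form_G_minus_form_A[OF assms(1)] by (simp only:) (simp (no_asm) add: field_simps)
  also have "\<dots> \<ge> 0" using assms by simp
  finally show "\<gamma> * form_A H H \<le> form_G c1 c2 \<kappa> ((2 * \<gamma>) *\<^sub>R mat 1) H H" by simp
qed

text \<open>The test matrix is the skew matrix of \<open>x\<close>, whose cofactor matrix is \<open>x x\<^sup>T\<close>.\<close>

lemma form_G_ge_imp_coercive:
  assumes "c1 + c2 = c" "form_G c1 c2 \<kappa> R \<succeq> (\<lambda>H L. \<gamma> * form_A H L)"
  shows "2 * \<gamma> * (x \<bullet> x) \<le> x \<bullet> (R *v x)"
proof -
  let ?H = "vector [vector [0, - x$3, x$2], vector [x$3, 0, - x$1], vector [- x$2, x$1, 0]] :: real^3^3"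
  have "0 \<le> form_G c1 c2 \<kappa> R ?H ?H - \<gamma> * form_A ?H ?H"
    using assms(2) by (simp add: form_ge_def)
  \<comment> \<open>Since \<open>transpose ?H = - ?H\<close> and the trace is 0, the terms in
    \<open>c\<close> and \<open>\<kappa>\<close> cancel. The squared norm of \<open>?H\<close> is
    \<open>2 * (x \<bullet> x)\<close>, whence the constant \<open>2 * \<gamma>\<close>.\<close>
  then show ?thesis
    unfolding form_G_minus_form_A[OF assms(1)]
    by (simp add: inner_vec_def sum_3 trace_def cof_def transpose_def matrix_vector_mult_def
          algebra_simps power2_eq_square)
qed

lemma form_G_ge_imp_le:
  assumes "c1 + c2 = c" "form_G c1 c2 \<kappa> R \<succeq> (\<lambda>H L. \<gamma> * form_A H L)"
  shows "\<gamma> \<le> c"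
proof -
  \<comment> \<open>On a rank-one matrix \<open>cof\<close> vanishes, so \<open>R\<close> plays no role.\<close>
  let ?H = "vector [vector [0, 1, 0], vector [0, 0, 0], vector [0, 0, 0]] :: real^3^3"
  have "0 \<le> form_G c1 c2 \<kappa> R ?H ?H - \<gamma> * form_A ?H ?H"
    using assms(2) by (simp add: form_ge_def)
  \<comment> \<open>\<open>trace ?H\<close> and \<open>?H \<bullet> transpose ?H\<close> vanish too,
    leaving \<open>2 * (c - \<gamma>) \<ge> 0\<close>.\<close>
  then show ?thesis
    unfolding form_G_minus_form_A[OF assms(1)]
    by (simp add: inner_vec_def sum_3 trace_def cof_def transpose_def)
qed

section \<open>Jacobians within a convex cell\<close>

text \<open>Boundary points are covered: both derivatives agree on \<open>y - x\<close> for
  \<open>y\<close> in \<open>S\<close>, and since \<open>S\<close> contains a ball, every direction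
  is a multiple of a difference of such vectors.\<close>

lemma frechet_derivative_unique_within_convex:
  fixes f :: "'a::real_normed_vector \<Rightarrow> 'b::real_normed_vector"
  assumes f: "(f has_derivative f') (at x within S)" "(f has_derivative f'') (at x within S)"
    and S: "convex S" "interior S \<noteq> {}" "x \<in> S"
  shows "f' = f''"
proof -
  interpret f': bounded_linear f' by (rule has_derivative_bounded_linear[OF f(1)])
  interpret f'': bounded_linear f'' by (rule has_derivative_bounded_linear[OF f(2)])
  have eq: "f' (y - x) = f'' (y - x)" if "y \<in> S" for y
  proof -
    \<comment> \<open>Along the segment from \<open>x\<close> to \<open>y\<close>, uniqueness on a
      closed interval applies even at its endpoint 0.\<close>
    let ?l = "\<lambda>t::real. x + t *\<^sub>R (y - x)"
    have sub: "?l ` cbox 0 1 \<subseteq> S"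
      using S(1,3) that by (auto simp: convex_alt algebra_simps)
    have l: "(?l has_derivative (\<lambda>t. t *\<^sub>R (y - x))) (at 0 within cbox 0 1)"
      by (auto intro!: derivative_eq_intros)
    have "((\<lambda>t. f (?l t)) has_derivative (\<lambda>t. g (t *\<^sub>R (y - x)))) (at 0 within cbox 0 1)"
      if "(f has_derivative g) (at x within S)" for g
      using has_derivative_in_compose[OF l, of f g] has_derivative_subset[OF that sub] by simp
    from frechet_derivative_unique_within_closed_interval[OF _ _ this[OF f(1)] this[OF f(2)]]
    have "(\<lambda>t. f' (t *\<^sub>R (y - x))) = (\<lambda>t. f'' (t *\<^sub>R (y - x)))" by simp
    from fun_cong[OF this, of 1] show ?thesis by simp
  qed
  obtain z e where e: "e > 0" "cball z e \<subseteq> S"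
    using S(2) by (meson ex_in_conv mem_interior_cball)
  have z: "z \<in> S" using e by auto
  show ?thesis
  proof
    fix h
    show "f' h = f'' h"
    proof (cases "h = 0")
      case False
      \<comment> \<open>The step \<open>r *\<^sub>R h\<close> has length \<open>e\<close>, so it
        stays in the closed ball around \<open>z\<close>.\<close>
      define r where "r = e / norm h"
      have r: "r > 0" and zr: "z + r *\<^sub>R h \<in> S"
        using e False by (auto simp: r_def dist_norm subset_iff)
      have "f' (z + r *\<^sub>R h - x) - f' (z - x) = f'' (z + r *\<^sub>R h - x) - f'' (z - x)"
        using eq[OF zr] eq[OF z] by simp
      then have "f' (r *\<^sub>R h) = f'' (r *\<^sub>R h)"
        unfolding f'.diff[symmetric] f''.diff[symmetric] by simp
      with r show ?thesis by (simp add: f'.scaleR f''.scaleR)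
    qed (simp add: f'.zero f''.zero)
  qed
qed

text \<open>\<open>jacobian\<close> rests on a chosen derivative; uniqueness lets any exhibited
  derivative compute it.\<close>

lemma jacobian_within_convex_eq:
  fixes f :: "real^'n \<Rightarrow> real^'m"
  assumes "(f has_derivative f') (at x within S)" "convex S" "interior S \<noteq> {}" "x \<in> S"
  shows "jacobian f (at x within S) = matrix f'"
proof -
  have "(f has_derivative frechet_derivative f (at x within S)) (at x within S)"
    using assms(1) differentiable_def frechet_derivative_works by blast
  from frechet_derivative_unique_within_convex[OF this assms] show ?thesis
    by (simp add: jacobian_def)
qed

lemma jacobian_matrix_vector_mult:
  fixes f :: "real^'n \<Rightarrow> real^'m" and A :: "real^'m^'k"
  assumes "f differentiable (at x within S)" "convex S" "interior S \<noteq> {}" "x \<in> S"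
  shows "jacobian (\<lambda>y. A *v f y) (at x within S) = A ** jacobian f (at x within S)"
proof -
  have "((\<lambda>y. A *v f y) has_derivative (\<lambda>h. A *v (jacobian f (at x within S) *v h))) (at x within S)"
    using assms(1) jacobian_works matrix_vector_mul_bounded_linear
    by (blast intro: bounded_linear.has_derivative)
  from jacobian_within_convex_eq[OF this assms(2-)] show ?thesis
    by (simp add: matrix_vector_mul_assoc)
qed

definition gradient :: "(real^'n \<Rightarrow> real) \<Rightarrow> (real^'n) filter \<Rightarrow> real^'n" where
  "gradient f net = (\<chi> j. frechet_derivative f net (axis j 1))"

definition outer :: "real^'m \<Rightarrow> real^'n \<Rightarrow> real^'n^'m" where
  "outer u v = (\<chi> i j. u $ i * v $ j)"

lemma jacobian_vector_basis:
  assumes "\<phi> a differentiable (at x within S)" "convex S" "interior S \<noteq> {}" "x \<in> S"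
  shows "jacobian (vector_basis \<phi> (a, i)) (at x within S) =
           outer (axis i 1) (gradient (\<phi> a) (at x within S))"
proof -
  have "((\<lambda>y. \<phi> a y *\<^sub>R axis i (1::real)) has_derivative
      (\<lambda>h. frechet_derivative (\<phi> a) (at x within S) h *\<^sub>R axis i 1)) (at x within S)"
    using assms(1) by (auto intro: derivative_intros simp: frechet_derivative_works)
  then have "(vector_basis \<phi> (a, i) has_derivative
      (\<lambda>h. frechet_derivative (\<phi> a) (at x within S) h *\<^sub>R axis i 1)) (at x within S)"
    by (simp add: vector_basis_def[abs_def])
  from jacobian_within_convex_eq[OF this assms(2-)] show ?thesis
    by (simp add: matrix_def outer_def gradient_def vec_eq_iff)
qed

section \<open>Structure of the defect matrix\<close>

text \<open>Rank-one matrices have zero cofactors, so only the mixed minors remain. The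
  factorization separates component directions from basis gradients.\<close>

lemma mat_cross_outer: "outer u x \<otimes> outer v y = outer (cross3 u v) (cross3 x y)"
  by (simp add: mat_cross_simps outer_def cross3_def algebra_simps)

lemma inner_outer: "A \<bullet> outer u v = u \<bullet> (A *v v)"
  by (simp add: outer_def inner_vec_def matrix_vector_mult_def sum_distrib_left algebra_simps)

text \<open>Over ordered pairs, each axis occurs twice up to sign, and \<open>i = j\<close>
  contributes zero.\<close>

lemma sum_cross3_axis_squares:
  "(\<Sum>i\<in>UNIV. \<Sum>j\<in>UNIV. (cross3 (axis i 1) (axis j 1) \<bullet> y)\<^sup>2) = 2 * (norm y)\<^sup>2"
  unfolding power2_norm_eq_inner inner_vec_def[of y y]
  by (simp add: sum_3 cross_basis inner_axis' power2_eq_square)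

lemma power2_norm_matrix: "(norm (A :: real^'n^'m))\<^sup>2 = (\<Sum>i\<in>UNIV. \<Sum>j\<in>UNIV. (A $ i $ j)\<^sup>2)"
  unfolding power2_norm_eq_inner by (simp add: inner_vec_def power2_eq_square)

definition moment_density ::
    "(real^3) set \<Rightarrow> (real^3 \<Rightarrow> real^3) \<Rightarrow> ('d \<Rightarrow> real^3 \<Rightarrow> real) \<Rightarrow> 'd \<Rightarrow> 'd \<Rightarrow> real^3 \<Rightarrow> real^3" where
  "moment_density K X \<phi> a b \<xi> = jacobian X (at \<xi> within K) *v
     cross3 (gradient (\<phi> a) (at \<xi> within K)) (gradient (\<phi> b) (at \<xi> within K))"

text \<open>These are the vectors \<open>z\<^sub>a\<^sub>b\<close> of the introductory idea.\<close>

definition moment ::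
    "(real^3) set \<Rightarrow> (real^3) set \<Rightarrow> (real^3 \<Rightarrow> real) \<Rightarrow> (real^3 \<Rightarrow> real^3) \<Rightarrow>
     ('d \<Rightarrow> real^3 \<Rightarrow> real) \<Rightarrow> 'd \<Rightarrow> 'd \<Rightarrow> real^3" where
  "moment K P w X \<phi> a b =
     (\<Sum>p\<in>P. w p *\<^sub>R moment_density K X \<phi> a b p) - integral K (moment_density K X \<phi> a b)"

text \<open>\<open>R\<close> leaves the Jacobian as a left factor, and pairing with a rank-one
  matrix is evaluation of a bilinear form.\<close>

lemma defect_integrand_eq:
  assumes "convex K" "interior K \<noteq> {}" "X differentiable_on K"
    and "\<And>a. \<phi> a differentiable_on K" and "\<xi> \<in> K"
  shows "defect_integrand K X R (vector_basis \<phi> (a, i)) (vector_basis \<phi> (b, j)) \<xi> =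
           cross3 (axis i 1) (axis j 1) \<bullet> (R *v moment_density K X \<phi> a b \<xi>)"
  using assms
  by (simp add: defect_integrand_def moment_density_def ddot_eq_inner differentiable_on_def
      jacobian_matrix_vector_mult jacobian_vector_basis mat_cross_outer inner_outer
      matrix_vector_mul_assoc)

lemma moment_density_integrable:
  assumes "convex K" "interior K \<noteq> {}" "X differentiable_on K"
    and "\<And>a. \<phi> a differentiable_on K"
    and int: "\<And>p q. defect_integrand K X (mat 1) (vector_basis \<phi> p) (vector_basis \<phi> q) integrable_on K"
  shows "moment_density K X \<phi> a b integrable_on K"
proof -
  have cross: "(\<lambda>\<xi>. cross3 (axis i 1) (axis j 1) \<bullet> moment_density K X \<phi> a b \<xi>) integrable_on K"
    for i j
    using int[of "(a, i)" "(b, j)"]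
    by (rule integrable_eq) (simp add: defect_integrand_eq[OF assms(1-4)])
  \<comment> \<open>Each axis is the cross product of the other two in cyclic order.\<close>
  have "(\<lambda>\<xi>. axis k 1 \<bullet> moment_density K X \<phi> a b \<xi>) integrable_on K" for k :: 3
    using exhaust_3[of k] cross[of 1 2] cross[of 2 3] cross[of 3 1] by (auto simp: cross_basis)
  then show ?thesis
    by (subst integrable_componentwise_iff) (auto simp: Basis_vec_def inner_commute)
qed

lemma defect_matrix_component:
  assumes "convex K" "interior K \<noteq> {}" "finite P" "P \<subseteq> K" "X differentiable_on K"
    and "\<And>a. \<phi> a differentiable_on K"
    and "\<And>p q. defect_integrand K X (mat 1) (vector_basis \<phi> p) (vector_basis \<phi> q) integrable_on K"
  shows "defect_matrix K P w X \<phi> R $ (a, i) $ (b, j) =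
           cross3 (axis i 1) (axis j 1) \<bullet> (R *v moment K P w X \<phi> a b)"
proof -
  \<comment> \<open>The weighted sum and the integral both commute with this bounded linear
    functional, so it can be pulled out of the cubature error.\<close>
  define f where "f = (\<lambda>x. cross3 (axis i 1) (axis j 1) \<bullet> (R *v x))"
  interpret f: bounded_linear f
    unfolding f_def
    by (intro bounded_linear_compose[OF bounded_linear_inner_right] matrix_vector_mul_bounded_linear)
  let ?z = "moment_density K X \<phi> a b"
  have eq: "defect_integrand K X R (vector_basis \<phi> (a, i)) (vector_basis \<phi> (b, j)) \<xi> = f (?z \<xi>)"
    if "\<xi> \<in> K" for \<xi>
    using defect_integrand_eq[OF assms(1,2,5,6) that] by (simp add: f_def)
  have "integral K (f \<circ> ?z) = f (integral K ?z)"
    by (rule integral_linear[OF moment_density_integrable[OF assms(1,2,5-7)] f.bounded_linear_axioms])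
  then have "integral K (defect_integrand K X R (vector_basis \<phi> (a, i)) (vector_basis \<phi> (b, j)))
      = f (integral K ?z)"
    using integral_cong[of K, OF eq] by (simp add: o_def)
  moreover have "(\<Sum>p\<in>P. w p * defect_integrand K X R (vector_basis \<phi> (a, i)) (vector_basis \<phi> (b, j)) p)
      = (\<Sum>p\<in>P. w p * f (?z p))"
    using assms(4) by (intro sum.cong) (auto simp: eq)
  ultimately have "defect_matrix K P w X \<phi> R $ (a, i) $ (b, j) = f (moment K P w X \<phi> a b)"
    by (simp add: defect_matrix_def cubature_error_def moment_def f.diff f.sum f.scaleR)
  then show ?thesis by (simp add: f_def)
qed

lemma norm_defect_matrix:
  fixes \<phi> :: "'d::finite \<Rightarrow> real^3 \<Rightarrow> real"
  assumes "convex K" "interior K \<noteq> {}" "finite P" "P \<subseteq> K" "X differentiable_on K"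
    and "\<And>a. \<phi> a differentiable_on K"
    and "\<And>p q. defect_integrand K X (mat 1) (vector_basis \<phi> p) (vector_basis \<phi> q) integrable_on K"
  shows "(norm (defect_matrix K P w X \<phi> R))\<^sup>2 =
           2 * (\<Sum>a\<in>UNIV. \<Sum>b\<in>UNIV. (norm (R *v moment K P w X \<phi> a b))\<^sup>2)"
proof -
  have "(norm (defect_matrix K P w X \<phi> R))\<^sup>2 =
      (\<Sum>a\<in>UNIV. \<Sum>i\<in>UNIV. \<Sum>b\<in>UNIV. \<Sum>j\<in>UNIV.
        (cross3 (axis i 1) (axis j 1) \<bullet> (R *v moment K P w X \<phi> a b))\<^sup>2)"
    by (simp only: power2_norm_matrix UNIV_Times_UNIV[symmetric] sum.cartesian_product'
        defect_matrix_component[OF assms])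
  also have "\<dots> = (\<Sum>a\<in>UNIV. \<Sum>b\<in>UNIV. 2 * (norm (R *v moment K P w X \<phi> a b))\<^sup>2)"
    \<comment> \<open>Exchanging the sums over \<open>i\<close> and \<open>b\<close> puts the
      component indices \<open>i\<close> and \<open>j\<close> innermost.\<close>
    by (subst sum.swap) (simp only: sum_cross3_axis_squares)
  finally show ?thesis by (simp add: sum_distrib_left)
qed

section \<open>Minimization\<close>

text \<open>Cauchy-Schwarz, then division by \<open>norm x\<close>.\<close>

lemma coercive_imp_norm_ge:
  fixes A :: "real^'n^'n"
  assumes "\<And>x. c * (x \<bullet> x) \<le> x \<bullet> (A *v x)"
  shows "c * norm x \<le> norm (A *v x)"
proof (cases "x = 0")
  case False
  have "norm x * (c * norm x) \<le> norm x * norm (A *v x)"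
    using order_trans[OF assms norm_cauchy_schwarz]
    by (simp add: power2_norm_eq_inner[symmetric] power2_eq_square mult_ac)
  with False show ?thesis by simp
qed simp

theorem theorem11:
  fixes c c1 c2 \<kappa> \<gamma> :: real
    and K P :: "(real^3) set"
    and w :: "real^3 \<Rightarrow> real"
    and X :: "real^3 \<Rightarrow> real^3"
    and \<phi> :: "'d::finite \<Rightarrow> real^3 \<Rightarrow> real"
  assumes "c1 \<ge> 0" "c2 \<ge> 0" "c1 + c2 = c" "c > 0" "\<kappa> \<ge> 0"
    and "compact K" "convex K" "interior K \<noteq> {}"
    and "finite P" "P \<subseteq> K"
    and "X differentiable_on K"
    and "\<And>a. \<phi> a differentiable_on K"
    and "linearly_independent_on K \<phi>"
    and "\<And>R p q. defect_integrand K X R (vector_basis \<phi> p) (vector_basis \<phi> q) integrable_on K"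
  shows "(0 < \<gamma> \<and> \<gamma> \<le> c \<longrightarrow>
            is_arg_min (\<lambda>R. norm (defect_matrix K P w X \<phi> R))
              (\<lambda>R. form_G c1 c2 \<kappa> R \<succeq> (\<lambda>H L. \<gamma> * form_A H L)) ((2 * \<gamma>) *\<^sub>R mat 1) \<and>
            Inf {norm (defect_matrix K P w X \<phi> R) | R.
                   form_G c1 c2 \<kappa> R \<succeq> (\<lambda>H L. \<gamma> * form_A H L)}
              = 2 * \<gamma> * norm (defect_matrix K P w X \<phi> (mat 1))) \<and>
         (\<gamma> > c \<longrightarrow> \<not> (\<exists>R. form_G c1 c2 \<kappa> R \<succeq> (\<lambda>H L. \<gamma> * form_A H L)))"
proof -
  let ?E = "defect_matrix K P w X \<phi>"
  let ?feasible = "\<lambda>R. form_G c1 c2 \<kappa> R \<succeq> (\<lambda>H L. \<gamma> * form_A H L)"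
  note norm_E = norm_defect_matrix[where w = w, OF assms(7-12,14)]
  have "is_arg_min (\<lambda>R. norm (?E R)) ?feasible ((2 * \<gamma>) *\<^sub>R mat 1) \<and>
      Inf {norm (?E R) | R. ?feasible R} = 2 * \<gamma> * norm (?E (mat 1))"
    if \<gamma>: "0 < \<gamma>" "\<gamma> \<le> c"
  proof -
    have feasible: "?feasible ((2 * \<gamma>) *\<^sub>R mat 1)"
      using form_G_scaled_id_ge[OF assms(3) \<gamma>(2) assms(5)] .
    have scaled: "norm (?E ((2 * \<gamma>) *\<^sub>R mat 1)) = 2 * \<gamma> * norm (?E (mat 1))"
    proof (rule power2_eq_imp_eq)
      show "(norm (?E ((2 * \<gamma>) *\<^sub>R mat 1)))\<^sup>2 = (2 * \<gamma> * norm (?E (mat 1)))\<^sup>2"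
        by (simp add: norm_E power_mult_distrib scaleR_matrix_vector_assoc[symmetric]
            sum_distrib_left mult_ac)
    qed (use \<gamma> in auto)
    have lower: "norm (?E ((2 * \<gamma>) *\<^sub>R mat 1)) \<le> norm (?E R)" if R: "?feasible R" for R
    proof (rule power2_le_imp_le)
      \<comment> \<open>The comparison holds for every vector \<open>z\<close>, so it applies to
        each summand of \<open>norm_E\<close> separately.\<close>
      have "2 * \<gamma> * norm z \<le> norm (R *v z)" for z
        by (rule coercive_imp_norm_ge) (rule form_G_ge_imp_coercive[OF assms(3) R])
      then have "(norm (((2 * \<gamma>) *\<^sub>R mat 1) *v z))\<^sup>2 \<le> (norm (R *v z))\<^sup>2" for z
        using \<gamma> by (intro power_mono) (simp_all add: scaleR_matrix_vector_assoc[symmetric])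
      then show "(norm (?E ((2 * \<gamma>) *\<^sub>R mat 1)))\<^sup>2 \<le> (norm (?E R))\<^sup>2"
        unfolding norm_E by (intro mult_left_mono sum_mono) auto
    qed simp
    have "Inf {norm (?E R) | R. ?feasible R} = norm (?E ((2 * \<gamma>) *\<^sub>R mat 1))"
      using feasible lower by (intro cInf_eq_minimum) auto
    with feasible lower scaled show ?thesis
      by (auto simp: is_arg_min_def not_less)
  qed
  moreover have "\<not> (\<exists>R. ?feasible R)" if "\<gamma> > c"
    using form_G_ge_imp_le[OF assms(3)] that by fastforce
  ultimately show ?thesis by blast
qed

end
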